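(* Let $(T,\cdot,e)$ and $(U,\cdot,e)$ be monoids, let $M$ be a $T$-graded monad and $P$ a $U$-graded monad on a category $\mathbf{C}$, and let $\lambda^{u,t}\colon P_uM_t\to M_tP_u$ ($u\in U$, $t\in T$) be a graded distributive law of $P$ over $M$. Then $\lambda$ induces a composite $(T\times U)$-graded monad with underlying functors $M_tP_u$: the family of endofunctors $(M_tP_u)_{(t,u)\in T\times U}$, together with the unit and multiplications induced by $\lambda$, is a $(T\times U)$-graded monad on $\mathbf{C}$.
   Context: A monad $M$ graded by a monoid $(T,\cdot,e)$ on a category $\mathbf{C}$ consists of endofunctors $M_t\colon\mathbf{C}\to\mathbf{C}$ ($t\in T$), natural transformations $\mu^{s,t}\colon M_sM_t\to M_{s\cdot t}$ ($s,t\in T$) and a natural transformation $\eta\colon \mathrm{Id}\to M_e$ such that $\mu^{r,s\cdot t}\circ M_r\mu^{s,t}=\mu^{r\cdot s,t}\circ\mu^{r,s}M_t$ and $\mu^{t,e}\circ M_t\eta=\mathrm{id}=\mu^{e,t}\circ\eta M_t$ for all $r,s,t\in T$. A graded distributive law of a $U$-graded monad $P$ over a $T$-graded monad $M$ is a family of natural transformations $\lambda^{u,t}\colon P_uM_t\to M_tP_u$ such that, for all $s,t\in T$, $u,v\in U$: (1) $\lambda^{u,s\cdot t}\circ P_u\mu^{s,t}=\mu^{s,t}P_u\circ M_s\lambda^{u,t}\circ\lambda^{u,s}M_t$; (2) $\lambda^{u\cdot v,t}\circ\mu^{u,v}M_t=M_t\mu^{u,v}\circ\lambda^{u,t}P_v\circ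 P_u\lambda^{v,t}$; (3) $\lambda^{u,e}\circ P_u\eta=\eta P_u$; (4) $\lambda^{e,t}\circ\eta M_t=M_t\eta$. The unit and multiplications induced by $\lambda$ are the horizontal composite of the two units, $\mathrm{Id}\to M_eP_e$, and the composites $M_sP_uM_tP_v\xrightarrow{M_s\lambda^{u,t}P_v}M_sM_tP_uP_v\to M_{s\cdot t}P_{u\cdot v}$, where the last arrow is the horizontal composite of $\mu^{s,t}$ (of $M$) and $\mu^{u,v}$ (of $P$). The product monoid $T\times U$ has componentwise operations. *)

theory Defs
  imports "HOL-Algebra.Group"
begin

section \<open>Categories, endofunctors and natural transformations\<close>

record ('o, 'm) category =
  Obj :: "'o set"
  Arr :: "'m set"
  Dom :: "'m \<Rightarrow> 'o"
  Cod :: "'m \<Rightarrow> 'o"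
  Ident :: "'o \<Rightarrow> 'm"
  Comp :: "'m \<Rightarrow> 'm \<Rightarrow> 'm"  (infixl \<open>\<cdot>\<index>\<close> 70)

definition Hom :: "('o, 'm, 'c) category_scheme \<Rightarrow> 'o \<Rightarrow> 'o \<Rightarrow> 'm set" where
  "Hom C X Y = {f \<in> Arr C. Dom C f = X \<and> Cod C f = Y}"

locale category =
  fixes C :: "('o, 'm, 'c) category_scheme" (structure)
  assumes Dom_closed: "f \<in> Arr C \<Longrightarrow> Dom C f \<in> Obj C"
    and Cod_closed: "f \<in> Arr C \<Longrightarrow> Cod C f \<in> Obj C"
    and Ident_in_Hom: "X \<in> Obj C \<Longrightarrow> Ident C X \<in> Hom C X X"
    and Comp_in_Hom: "\<lbrakk>f \<in> Hom C X Y; g \<in> Hom C Y Z\<rbrakk> \<Longrightarrow> g \<cdot> f \<in> Hom C X Z"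
    and Comp_Ident: "f \<in> Hom C X Y \<Longrightarrow> f \<cdot> Ident C X = f"
    and Ident_Comp: "f \<in> Hom C X Y \<Longrightarrow> Ident C Y \<cdot> f = f"
    and Comp_assoc: "\<lbrakk>f \<in> Hom C W X; g \<in> Hom C X Y; h \<in> Hom C Y Z\<rbrakk>
      \<Longrightarrow> (h \<cdot> g) \<cdot> f = h \<cdot> (g \<cdot> f)"

record ('o, 'm) endofunctor =
  on_obj :: "'o \<Rightarrow> 'o"
  on_arr :: "'m \<Rightarrow> 'm"

locale endofunctor = category C
  for C :: "('o, 'm, 'c) category_scheme" (structure) +
  fixes F :: "('o, 'm) endofunctor"
  assumes on_obj_closed: "X \<in> Obj C \<Longrightarrow> on_obj F X \<in> Obj C"
    and on_arr_Hom: "f \<in> Hom C X Y \<Longrightarrow> on_arr F f \<in> Hom C (on_obj F X) (on_obj F Y)"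
    and on_arr_Ident: "X \<in> Obj C \<Longrightarrow> on_arr F (Ident C X) = Ident C (on_obj F X)"
    and on_arr_Comp: "\<lbrakk>f \<in> Hom C X Y; g \<in> Hom C Y Z\<rbrakk>
      \<Longrightarrow> on_arr F (g \<cdot> f) = on_arr F g \<cdot> on_arr F f"

definition id_functor :: "('o, 'm) endofunctor" where
  "id_functor = \<lparr>on_obj = (\<lambda>X. X), on_arr = (\<lambda>f. f)\<rparr>"

definition comp_functor ::
    "('o, 'm) endofunctor \<Rightarrow> ('o, 'm) endofunctor \<Rightarrow> ('o, 'm) endofunctor"
    (infixr \<open>\<circ>F\<close> 75) where
  "F \<circ>F G = \<lparr>on_obj = (\<lambda>X. on_obj F (on_obj G X)), on_arr = (\<lambda>f. on_arr F (on_arr G f))\<rparr>"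

text \<open>
  A natural transformation is given by its family of components. Only the components at
  objects of the category are meaningful; the operations below therefore restrict their
  results to the objects, so that HOL equality between results of these operations is
  equality of natural transformations.
\<close>

locale natural_transformation =
  source: endofunctor C F + target: endofunctor C G
  for C :: "('o, 'm, 'c) category_scheme" (structure)
    and F G :: "('o, 'm) endofunctor" +
  fixes \<alpha> :: "'o \<Rightarrow> 'm"
  assumes component_in_Hom: "X \<in> Obj C \<Longrightarrow> \<alpha> X \<in> Hom C (on_obj F X) (on_obj G X)"
    and naturality: "f \<in> Hom C X Y \<Longrightarrow> \<alpha> Y \<cdot> on_arr F f = on_arr G f \<cdot> \<alpha> X"

definition id_nt :: "('o, 'm, 'c) category_scheme \<Rightarrow> ('o, 'm) endofunctor \<Rightarrow> 'o \<Rightarrow> 'm" where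
  "id_nt C F = (\<lambda>X\<in>Obj C. Ident C (on_obj F X))"

definition vcomp ::
    "('o, 'm, 'c) category_scheme \<Rightarrow> ('o \<Rightarrow> 'm) \<Rightarrow> ('o \<Rightarrow> 'm) \<Rightarrow> 'o \<Rightarrow> 'm"
    (infixl \<open>\<circ>V\<index>\<close> 65) where
  "\<beta> \<circ>V\<^bsub>C\<^esub> \<alpha> = (\<lambda>X\<in>Obj C. \<beta> X \<cdot>\<^bsub>C\<^esub> \<alpha> X)"

text \<open>The whiskerings \<open>F\<alpha>\<close> and \<open>\<alpha>F\<close>.\<close>

definition whisker_left ::
    "('o, 'm, 'c) category_scheme \<Rightarrow> ('o, 'm) endofunctor \<Rightarrow> ('o \<Rightarrow> 'm) \<Rightarrow> 'o \<Rightarrow> 'm"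
    (infixr \<open>\<rhd>\<index>\<close> 70) where
  "F \<rhd>\<^bsub>C\<^esub> \<alpha> = (\<lambda>X\<in>Obj C. on_arr F (\<alpha> X))"

definition whisker_right ::
    "('o, 'm, 'c) category_scheme \<Rightarrow> ('o \<Rightarrow> 'm) \<Rightarrow> ('o, 'm) endofunctor \<Rightarrow> 'o \<Rightarrow> 'm"
    (infixl \<open>\<lhd>R\<index>\<close> 70) where
  "\<alpha> \<lhd>R\<^bsub>C\<^esub> F = (\<lambda>X\<in>Obj C. \<alpha> (on_obj F X))"

text \<open>
  The horizontal composite \<open>FH \<rightarrow> GK\<close> of \<open>\<alpha> : F \<rightarrow> G\<close> and \<open>\<beta> : H \<rightarrow> K\<close>, taken as
  \<open>\<alpha>K \<circ> F\<beta>\<close>. By naturality of \<open>\<alpha>\<close> it also equals \<open>G\<beta> \<circ> \<alpha>H\<close>, see \<open>hcomp_alt\<close> below.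
\<close>

definition hcomp ::
    "('o, 'm, 'c) category_scheme \<Rightarrow> ('o, 'm) endofunctor \<Rightarrow> ('o, 'm) endofunctor
      \<Rightarrow> ('o \<Rightarrow> 'm) \<Rightarrow> ('o \<Rightarrow> 'm) \<Rightarrow> 'o \<Rightarrow> 'm" where
  "hcomp C F K \<alpha> \<beta> = (\<alpha> \<lhd>R\<^bsub>C\<^esub> K) \<circ>V\<^bsub>C\<^esub> (F \<rhd>\<^bsub>C\<^esub> \<beta>)"

lemma hcomp_alt:
  assumes "natural_transformation C F G \<alpha>" and "natural_transformation C H K \<beta>"
  shows "hcomp C F K \<alpha> \<beta> = (G \<rhd>\<^bsub>C\<^esub> \<beta>) \<circ>V\<^bsub>C\<^esub> (\<alpha> \<lhd>R\<^bsub>C\<^esub> H)"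
  using natural_transformation.naturality[OF assms(1)
      natural_transformation.component_in_Hom[OF assms(2)]]
  by (simp add: hcomp_def vcomp_def whisker_left_def whisker_right_def cong: restrict_cong)


section \<open>Graded monads and graded distributive laws\<close>

locale graded_monad = monoid T + category C
  for T :: "('t, 'a) monoid_scheme" and C :: "('o, 'm, 'c) category_scheme" +
  fixes M :: "'t \<Rightarrow> ('o, 'm) endofunctor"
    and \<mu> :: "'t \<Rightarrow> 't \<Rightarrow> 'o \<Rightarrow> 'm"
    and \<eta> :: "'o \<Rightarrow> 'm"
  assumes functor_M: "t \<in> carrier T \<Longrightarrow> endofunctor C (M t)"
    and natural_mult: "\<lbrakk>s \<in> carrier T; t \<in> carrier T\<rbrakk>
      \<Longrightarrow> natural_transformation C (M s \<circ>F M t) (M (s \<otimes>\<^bsub>T\<^esub> t)) (\<mu> s t)"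
    and natural_unit: "natural_transformation C id_functor (M \<one>\<^bsub>T\<^esub>) \<eta>"
    and mult_assoc: "\<lbrakk>r \<in> carrier T; s \<in> carrier T; t \<in> carrier T\<rbrakk>
      \<Longrightarrow> \<mu> r (s \<otimes>\<^bsub>T\<^esub> t) \<circ>V\<^bsub>C\<^esub> (M r \<rhd>\<^bsub>C\<^esub> \<mu> s t)
        = \<mu> (r \<otimes>\<^bsub>T\<^esub> s) t \<circ>V\<^bsub>C\<^esub> (\<mu> r s \<lhd>R\<^bsub>C\<^esub> M t)"
    and mult_unit_right: "t \<in> carrier T
      \<Longrightarrow> \<mu> t \<one>\<^bsub>T\<^esub> \<circ>V\<^bsub>C\<^esub> (M t \<rhd>\<^bsub>C\<^esub> \<eta>) = id_nt C (M t)"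
    and mult_unit_left: "t \<in> carrier T
      \<Longrightarrow> \<mu> \<one>\<^bsub>T\<^esub> t \<circ>V\<^bsub>C\<^esub> (\<eta> \<lhd>R\<^bsub>C\<^esub> M t) = id_nt C (M t)"

locale graded_distributive_law =
  M: graded_monad T C M \<mu>M \<eta>M + P: graded_monad U C P \<mu>P \<eta>P
  for T :: "('t, 'a) monoid_scheme" and U :: "('u, 'b) monoid_scheme"
    and C :: "('o, 'm, 'c) category_scheme"
    and M :: "'t \<Rightarrow> ('o, 'm) endofunctor"
    and \<mu>M :: "'t \<Rightarrow> 't \<Rightarrow> 'o \<Rightarrow> 'm" and \<eta>M :: "'o \<Rightarrow> 'm"
    and P :: "'u \<Rightarrow> ('o, 'm) endofunctor"
    and \<mu>P :: "'u \<Rightarrow> 'u \<Rightarrow> 'o \<Rightarrow> 'm" and \<eta>P :: "'o \<Rightarrow> 'm" +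
  fixes lam :: "'u \<Rightarrow> 't \<Rightarrow> 'o \<Rightarrow> 'm"
  assumes natural_law: "\<lbrakk>u \<in> carrier U; t \<in> carrier T\<rbrakk>
      \<Longrightarrow> natural_transformation C (P u \<circ>F M t) (M t \<circ>F P u) (lam u t)"
    and law_mult_M: "\<lbrakk>u \<in> carrier U; s \<in> carrier T; t \<in> carrier T\<rbrakk>
      \<Longrightarrow> lam u (s \<otimes>\<^bsub>T\<^esub> t) \<circ>V\<^bsub>C\<^esub> (P u \<rhd>\<^bsub>C\<^esub> \<mu>M s t)
        = (\<mu>M s t \<lhd>R\<^bsub>C\<^esub> P u) \<circ>V\<^bsub>C\<^esub> (M s \<rhd>\<^bsub>C\<^esub> lam u t) \<circ>V\<^bsub>C\<^esub> (lam u s \<lhd>R\<^bsub>C\<^esub> M t)"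
    and law_mult_P: "\<lbrakk>u \<in> carrier U; v \<in> carrier U; t \<in> carrier T\<rbrakk>
      \<Longrightarrow> lam (u \<otimes>\<^bsub>U\<^esub> v) t \<circ>V\<^bsub>C\<^esub> (\<mu>P u v \<lhd>R\<^bsub>C\<^esub> M t)
        = (M t \<rhd>\<^bsub>C\<^esub> \<mu>P u v) \<circ>V\<^bsub>C\<^esub> (lam u t \<lhd>R\<^bsub>C\<^esub> P v) \<circ>V\<^bsub>C\<^esub> (P u \<rhd>\<^bsub>C\<^esub> lam v t)"
    and law_unit_M: "u \<in> carrier U
      \<Longrightarrow> lam u \<one>\<^bsub>T\<^esub> \<circ>V\<^bsub>C\<^esub> (P u \<rhd>\<^bsub>C\<^esub> \<eta>M) = \<eta>M \<lhd>R\<^bsub>C\<^esub> P u"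
    and law_unit_P: "t \<in> carrier T
      \<Longrightarrow> lam \<one>\<^bsub>U\<^esub> t \<circ>V\<^bsub>C\<^esub> (\<eta>P \<lhd>R\<^bsub>C\<^esub> M t) = M t \<rhd>\<^bsub>C\<^esub> \<eta>P"

definition composite_functor ::
    "('t \<Rightarrow> ('o, 'm) endofunctor) \<Rightarrow> ('u \<Rightarrow> ('o, 'm) endofunctor)
      \<Rightarrow> 't \<times> 'u \<Rightarrow> ('o, 'm) endofunctor" where
  "composite_functor M P = (\<lambda>(t, u). M t \<circ>F P u)"

definition composite_unit ::
    "('u, 'b) monoid_scheme \<Rightarrow> ('o, 'm, 'c) category_scheme \<Rightarrow> ('u \<Rightarrow> ('o, 'm) endofunctor)
      \<Rightarrow> ('o \<Rightarrow> 'm) \<Rightarrow> ('o \<Rightarrow> 'm) \<Rightarrow> 'o \<Rightarrow> 'm" where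
  "composite_unit U C P \<eta>M \<eta>P = hcomp C id_functor (P \<one>\<^bsub>U\<^esub>) \<eta>M \<eta>P"

definition composite_mult ::
    "('u, 'b) monoid_scheme \<Rightarrow> ('o, 'm, 'c) category_scheme
      \<Rightarrow> ('t \<Rightarrow> ('o, 'm) endofunctor) \<Rightarrow> ('t \<Rightarrow> 't \<Rightarrow> 'o \<Rightarrow> 'm)
      \<Rightarrow> ('u \<Rightarrow> ('o, 'm) endofunctor) \<Rightarrow> ('u \<Rightarrow> 'u \<Rightarrow> 'o \<Rightarrow> 'm)
      \<Rightarrow> ('u \<Rightarrow> 't \<Rightarrow> 'o \<Rightarrow> 'm) \<Rightarrow> 't \<times> 'u \<Rightarrow> 't \<times> 'u \<Rightarrow> 'o \<Rightarrow> 'm" where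
  "composite_mult U C M \<mu>M P \<mu>P lam = (\<lambda>(s, u) (t, v).
     hcomp C (M s \<circ>F M t) (P (u \<otimes>\<^bsub>U\<^esub> v)) (\<mu>M s t) (\<mu>P u v)
       \<circ>V\<^bsub>C\<^esub> (M s \<rhd>\<^bsub>C\<^esub> (lam u t \<lhd>R\<^bsub>C\<^esub> P v)))"

end

theory Submission
  imports Defs
begin

text \<open>
  In the associativity law both sides are brought to the form
  \<open>\<mu>M \<cdot> \<mu>M \<cdot> MMM(\<mu>P \<cdot> \<mu>P) \<cdot> MM(\<lambda>P \<cdot> P\<lambda>) \<cdot> M\<lambda>\<close>: on the right-hand side by pulling \<open>\<mu>M\<close> to the
  front and applying the compatibility of \<open>\<lambda>\<close> with \<open>\<mu>P\<close>, on the left-hand side by applying the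
  compatibility of \<open>\<lambda>\<close> with \<open>\<mu>M\<close> and pulling \<open>\<mu>P\<close> to the front. Associativity of \<open>M\<close> and of \<open>P\<close>
  then identifies the two.
\<close>

section \<open>Typing rules for rewriting\<close>

text \<open>
  The axioms of Defs are phrased with \<open>Hom C X Y\<close>, whose objects the simplifier cannot guess;
  with \<open>Arr\<close>, \<open>Dom\<close> and \<open>Cod\<close> they become conditional rewrite rules.
\<close>

lemma Hom_iff: "f \<in> Hom C X Y \<longleftrightarrow> f \<in> Arr C \<and> Dom C f = X \<and> Cod C f = Y"
  by (simp add: Hom_def)

context category
begin

lemma Comp_typing:
  assumes "f \<in> Arr C" "g \<in> Arr C" "Cod C f = Dom C g"
  shows "g \<cdot> f \<in> Arr C" "Dom C (g \<cdot> f) = Dom C f" "Cod C (g \<cdot> f) = Cod C g"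
  using Comp_in_Hom[of f "Dom C f" "Dom C g" g "Cod C g"] assms by (auto simp: Hom_iff)

lemma Comp_assoc_Arr:
  assumes "f \<in> Arr C" "g \<in> Arr C" "h \<in> Arr C" "Cod C f = Dom C g" "Cod C g = Dom C h"
  shows "(h \<cdot> g) \<cdot> f = h \<cdot> (g \<cdot> f)"
  using Comp_assoc[of f "Dom C f" "Dom C g" g "Dom C h" h "Cod C h"] assms by (auto simp: Hom_iff)

lemma Ident_typing:
  assumes "X \<in> Obj C"
  shows "Ident C X \<in> Arr C" "Dom C (Ident C X) = X" "Cod C (Ident C X) = X"
  using Ident_in_Hom[OF assms] by (auto simp: Hom_iff)

text \<open>The equation \<open>X = Dom C f\<close> is a premise, so the rule fires on an identity
  at any object term that the typing rules can evaluate to the domain.\<close>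

lemma Comp_Ident_Arr: "f \<in> Arr C \<Longrightarrow> X = Dom C f \<Longrightarrow> f \<cdot> Ident C X = f"
  using Comp_Ident[of f "Dom C f" "Cod C f"] by (auto simp: Hom_iff)

lemma Ident_Comp_Arr: "f \<in> Arr C \<Longrightarrow> X = Cod C f \<Longrightarrow> Ident C X \<cdot> f = f"
  using Ident_Comp[of f "Dom C f" "Cod C f"] by (auto simp: Hom_iff)

text \<open>These rules nest composites to the right and delete identities. Together with
  \<open>functor_simps\<close>, which distributes functors over composites, they give a normal form
  that settles every step consisting only of rebracketing and functoriality.\<close>

lemmas Arr_simps = Dom_closed Cod_closed Comp_typing Comp_assoc_Arr Ident_typing
  Comp_Ident_Arr Ident_Comp_Arr

end

context endofunctor
begin

lemma on_arr_typing:
  assumes "f \<in> Arr C"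
  shows "on_arr F f \<in> Arr C" "Dom C (on_arr F f) = on_obj F (Dom C f)"
    "Cod C (on_arr F f) = on_obj F (Cod C f)"
  using on_arr_Hom[of f "Dom C f" "Cod C f"] assms by (auto simp: Hom_iff)

lemma on_arr_Comp_Arr:
  assumes "f \<in> Arr C" "g \<in> Arr C" "Cod C f = Dom C g"
  shows "on_arr F (g \<cdot> f) = on_arr F g \<cdot> on_arr F f"
  using on_arr_Comp[of f "Dom C f" "Dom C g" g "Cod C g"] assms by (auto simp: Hom_iff)

lemmas functor_simps = on_obj_closed on_arr_typing on_arr_Ident on_arr_Comp_Arr

end

context natural_transformation
begin

lemma component_typing:
  assumes "X \<in> Obj C"
  shows "\<alpha> X \<in> Arr C" "Dom C (\<alpha> X) = on_obj F X" "Cod C (\<alpha> X) = on_obj G X"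
  using component_in_Hom[OF assms] by (auto simp: Hom_iff)

text \<open>Meant to be instantiated at a named arrow: as a rewrite rule it would rarely match,
  since the typing rules evaluate the \<open>Cod C f\<close> in its pattern.\<close>

lemma naturality_Arr:
  "f \<in> Arr C \<Longrightarrow> \<alpha> (Cod C f) \<cdot> on_arr F f = on_arr G f \<cdot> \<alpha> (Dom C f)"
  using naturality[of f "Dom C f" "Cod C f"] by (auto simp: Hom_iff)

end

section \<open>Operations on functors and natural transformations\<close>

lemma comp_functor_simps [simp]:
  "on_obj (F \<circ>F G) X = on_obj F (on_obj G X)" "on_arr (F \<circ>F G) f = on_arr F (on_arr G f)"
  by (simp_all add: comp_functor_def)

lemma id_functor_simps [simp]: "on_obj id_functor X = X" "on_arr id_functor f = f"
  by (simp_all add: id_functor_def)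

text \<open>Functors are records of functions, so composition is associative on the nose and no
  associator isomorphisms appear.\<close>

lemma comp_functor_assoc: "(F \<circ>F G) \<circ>F H = F \<circ>F (G \<circ>F H)"
  by (simp add: comp_functor_def)

lemma comp_id_functor: "id_functor \<circ>F F = F"
  by (simp add: comp_functor_def id_functor_def)

lemma endofunctor_comp:
  assumes "endofunctor C F" "endofunctor C G"
  shows "endofunctor C (F \<circ>F G)"
proof -
  interpret F: endofunctor C F by fact
  interpret G: endofunctor C G by fact
  show ?thesis
    by unfold_locales
      (auto simp: Hom_iff F.Arr_simps F.functor_simps G.functor_simps)
qed

text \<open>Paste the two naturality squares along their common edge
  \<open>on_arr G f\<close>.\<close>

lemma natural_transformation_vcomp:
  assumes "natural_transformation C F G \<alpha>" "natural_transformation C G H \<beta>"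
  shows "natural_transformation C F H (\<beta> \<circ>V\<^bsub>C\<^esub> \<alpha>)"
proof -
  interpret \<alpha>: natural_transformation C F G \<alpha> by fact
  interpret \<beta>: natural_transformation C G H \<beta> by fact
  show ?thesis
  proof unfold_locales
    fix f X Y assume "f \<in> Hom C X Y"
    then have f: "f \<in> Arr C" "Dom C f = X" "Cod C f = Y" "X \<in> Obj C" "Y \<in> Obj C"
      by (auto simp: Hom_iff \<alpha>.source.Arr_simps)
    have "(\<beta> Y \<cdot>\<^bsub>C\<^esub> \<alpha> Y) \<cdot>\<^bsub>C\<^esub> on_arr F f = \<beta> Y \<cdot>\<^bsub>C\<^esub> (on_arr G f \<cdot>\<^bsub>C\<^esub> \<alpha> X)"
      using f \<alpha>.naturality_Arr[of f]
      by (simp add: \<alpha>.source.Arr_simps \<alpha>.source.functor_simps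
          \<alpha>.component_typing \<beta>.component_typing)
    also have "\<dots> = (\<beta> Y \<cdot>\<^bsub>C\<^esub> on_arr G f) \<cdot>\<^bsub>C\<^esub> \<alpha> X"
      using f by (simp add: \<alpha>.source.Arr_simps \<alpha>.target.functor_simps
          \<alpha>.component_typing \<beta>.component_typing)
    also have "\<dots> = on_arr H f \<cdot>\<^bsub>C\<^esub> (\<beta> X \<cdot>\<^bsub>C\<^esub> \<alpha> X)"
      using f \<beta>.naturality_Arr[of f]
      by (simp add: \<alpha>.source.Arr_simps \<beta>.target.functor_simps
          \<alpha>.component_typing \<beta>.component_typing)
    finally show "(\<beta> \<circ>V\<^bsub>C\<^esub> \<alpha>) Y \<cdot>\<^bsub>C\<^esub> on_arr F f = on_arr H f \<cdot>\<^bsub>C\<^esub> (\<beta> \<circ>V\<^bsub>C\<^esub> \<alpha>) X"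
      using f by (simp add: vcomp_def)
  qed (auto simp: Hom_iff vcomp_def \<alpha>.source.Arr_simps \<alpha>.component_typing \<beta>.component_typing)
qed

text \<open>Apply \<open>H\<close> to the naturality square of \<alpha>. Functoriality is used from
  right to left, so that the two images merge into the image of one side of the square.\<close>

lemma natural_transformation_whisker_left:
  assumes "endofunctor C H" "natural_transformation C F G \<alpha>"
  shows "natural_transformation C (H \<circ>F F) (H \<circ>F G) (H \<rhd>\<^bsub>C\<^esub> \<alpha>)"
proof -
  interpret H: endofunctor C H by fact
  interpret \<alpha>: natural_transformation C F G \<alpha> by fact
  interpret HF: endofunctor C "H \<circ>F F" by (intro endofunctor_comp assms \<alpha>.source.endofunctor_axioms)
  interpret HG: endofunctor C "H \<circ>F G" by (intro endofunctor_comp assms \<alpha>.target.endofunctor_axioms)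
  show ?thesis
  proof unfold_locales
    fix f X Y assume "f \<in> Hom C X Y"
    then have f: "f \<in> Arr C" "Dom C f = X" "Cod C f = Y" "X \<in> Obj C" "Y \<in> Obj C"
      by (auto simp: Hom_iff H.Arr_simps)
    then show "(H \<rhd>\<^bsub>C\<^esub> \<alpha>) Y \<cdot>\<^bsub>C\<^esub> on_arr (H \<circ>F F) f = on_arr (H \<circ>F G) f \<cdot>\<^bsub>C\<^esub> (H \<rhd>\<^bsub>C\<^esub> \<alpha>) X"
      using \<alpha>.naturality_Arr[of f]
      by (simp add: whisker_left_def H.on_arr_Comp_Arr[symmetric] \<alpha>.source.functor_simps
          \<alpha>.target.functor_simps \<alpha>.component_typing)
  qed (auto simp: Hom_iff whisker_left_def H.functor_simps \<alpha>.component_typing)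
qed

text \<open>This is the naturality square of \<alpha> at the arrow
  \<open>on_arr H f\<close>.\<close>

lemma natural_transformation_whisker_right:
  assumes "natural_transformation C F G \<alpha>" "endofunctor C H"
  shows "natural_transformation C (F \<circ>F H) (G \<circ>F H) (\<alpha> \<lhd>R\<^bsub>C\<^esub> H)"
proof -
  interpret H: endofunctor C H by fact
  interpret \<alpha>: natural_transformation C F G \<alpha> by fact
  interpret FH: endofunctor C "F \<circ>F H" by (intro endofunctor_comp assms \<alpha>.source.endofunctor_axioms)
  interpret GH: endofunctor C "G \<circ>F H" by (intro endofunctor_comp assms \<alpha>.target.endofunctor_axioms)
  show ?thesis
  proof unfold_locales
    fix f X Y assume "f \<in> Hom C X Y"
    then have f: "f \<in> Arr C" "Dom C f = X" "Cod C f = Y" "X \<in> Obj C" "Y \<in> Obj C"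
      by (auto simp: Hom_iff H.Arr_simps)
    then show "(\<alpha> \<lhd>R\<^bsub>C\<^esub> H) Y \<cdot>\<^bsub>C\<^esub> on_arr (F \<circ>F H) f = on_arr (G \<circ>F H) f \<cdot>\<^bsub>C\<^esub> (\<alpha> \<lhd>R\<^bsub>C\<^esub> H) X"
      using \<alpha>.naturality_Arr[of "on_arr H f"]
      by (simp add: whisker_right_def H.functor_simps)
  qed (auto simp: Hom_iff whisker_right_def H.functor_simps \<alpha>.component_typing)
qed

lemma natural_transformation_hcomp:
  assumes "natural_transformation C F G \<alpha>" "natural_transformation C H K \<beta>"
  shows "natural_transformation C (F \<circ>F H) (G \<circ>F K) (hcomp C F K \<alpha> \<beta>)"
proof -
  interpret \<alpha>: natural_transformation C F G \<alpha> by fact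
  interpret \<beta>: natural_transformation C H K \<beta> by fact
  show ?thesis unfolding hcomp_def
    by (rule natural_transformation_vcomp natural_transformation_whisker_left
        natural_transformation_whisker_right assms \<alpha>.source.endofunctor_axioms
        \<beta>.target.endofunctor_axioms)+
qed

section \<open>Graded monads and distributive laws in components\<close>

context graded_monad
begin

lemmas M_simps =
  endofunctor.functor_simps[OF functor_M]

lemma mult_typing:
  assumes "s \<in> carrier T" "t \<in> carrier T" "X \<in> Obj C"
  shows "\<mu> s t X \<in> Arr C" "Dom C (\<mu> s t X) = on_obj (M s) (on_obj (M t) X)"
    "Cod C (\<mu> s t X) = on_obj (M (s \<otimes>\<^bsub>T\<^esub> t)) X"
  using natural_transformation.component_typing[OF natural_mult] assms by simp_all

lemma unit_typing:
  assumes "X \<in> Obj C"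
  shows "\<eta> X \<in> Arr C" "Dom C (\<eta> X) = X" "Cod C (\<eta> X) = on_obj (M \<one>\<^bsub>T\<^esub>) X"
  using natural_transformation.component_typing[OF natural_unit] assms by simp_all

lemma mult_natural:
  assumes "s \<in> carrier T" "t \<in> carrier T" "f \<in> Arr C"
  shows "\<mu> s t (Cod C f) \<cdot>\<^bsub>C\<^esub> on_arr (M s) (on_arr (M t) f)
    = on_arr (M (s \<otimes>\<^bsub>T\<^esub> t)) f \<cdot>\<^bsub>C\<^esub> \<mu> s t (Dom C f)"
  using natural_transformation.naturality_Arr[OF natural_mult] assms by simp

lemma unit_natural: "f \<in> Arr C \<Longrightarrow> \<eta> (Cod C f) \<cdot>\<^bsub>C\<^esub> f = on_arr (M \<one>\<^bsub>T\<^esub>) f \<cdot>\<^bsub>C\<^esub> \<eta> (Dom C f)"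
  using natural_transformation.naturality_Arr[OF natural_unit] by simp

text \<open>The graded law equates two families restricted to the objects; evaluating both at an
  object \<open>X\<close> removes the restriction.\<close>

lemma mult_assoc_component:
  assumes "r \<in> carrier T" "s \<in> carrier T" "t \<in> carrier T" "X \<in> Obj C"
  shows "\<mu> r (s \<otimes>\<^bsub>T\<^esub> t) X \<cdot>\<^bsub>C\<^esub> on_arr (M r) (\<mu> s t X)
    = \<mu> (r \<otimes>\<^bsub>T\<^esub> s) t X \<cdot>\<^bsub>C\<^esub> \<mu> r s (on_obj (M t) X)"
  using fun_cong[OF mult_assoc, of r s t X] assms
  by (simp add: vcomp_def whisker_left_def whisker_right_def)

lemma mult_unit_right_component:
  "t \<in> carrier T \<Longrightarrow> X \<in> Obj C
    \<Longrightarrow> \<mu> t \<one>\<^bsub>T\<^esub> X \<cdot>\<^bsub>C\<^esub> on_arr (M t) (\<eta> X) = Ident C (on_obj (M t) X)"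
  using fun_cong[OF mult_unit_right, of t X] by (simp add: vcomp_def whisker_left_def id_nt_def)

lemma mult_unit_left_component:
  "t \<in> carrier T \<Longrightarrow> X \<in> Obj C
    \<Longrightarrow> \<mu> \<one>\<^bsub>T\<^esub> t X \<cdot>\<^bsub>C\<^esub> \<eta> (on_obj (M t) X) = Ident C (on_obj (M t) X)"
  using fun_cong[OF mult_unit_left, of t X] by (simp add: vcomp_def whisker_right_def id_nt_def)

end

context graded_distributive_law
begin

lemma law_typing:
  assumes "u \<in> carrier U" "t \<in> carrier T" "X \<in> Obj C"
  shows "lam u t X \<in> Arr C" "Dom C (lam u t X) = on_obj (P u) (on_obj (M t) X)"
    "Cod C (lam u t X) = on_obj (M t) (on_obj (P u) X)"
  using natural_transformation.component_typing[OF natural_law] assms by simp_all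

lemma law_natural:
  assumes "u \<in> carrier U" "t \<in> carrier T" "f \<in> Arr C"
  shows "lam u t (Cod C f) \<cdot>\<^bsub>C\<^esub> on_arr (P u) (on_arr (M t) f)
    = on_arr (M t) (on_arr (P u) f) \<cdot>\<^bsub>C\<^esub> lam u t (Dom C f)"
  using natural_transformation.naturality_Arr[OF natural_law] assms by simp

lemmas typing = M.Arr_simps M.M_simps P.M_simps M.mult_typing P.mult_typing
  M.unit_typing P.unit_typing law_typing

text \<open>The right-hand side is bracketed to the right, in accordance with the simplifier's
  normal form.\<close>

lemma law_mult_M_component:
  assumes "u \<in> carrier U" "s \<in> carrier T" "t \<in> carrier T" "X \<in> Obj C"
  shows "lam u (s \<otimes>\<^bsub>T\<^esub> t) X \<cdot>\<^bsub>C\<^esub> on_arr (P u) (\<mu>M s t X)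
    = \<mu>M s t (on_obj (P u) X) \<cdot>\<^bsub>C\<^esub> (on_arr (M s) (lam u t X) \<cdot>\<^bsub>C\<^esub> lam u s (on_obj (M t) X))"
  using fun_cong[OF law_mult_M, of u s t X] assms
  by (simp add: vcomp_def whisker_left_def whisker_right_def typing)

lemma law_mult_P_component:
  assumes "u \<in> carrier U" "v \<in> carrier U" "t \<in> carrier T" "X \<in> Obj C"
  shows "lam (u \<otimes>\<^bsub>U\<^esub> v) t X \<cdot>\<^bsub>C\<^esub> \<mu>P u v (on_obj (M t) X)
    = on_arr (M t) (\<mu>P u v X) \<cdot>\<^bsub>C\<^esub> (lam u t (on_obj (P v) X) \<cdot>\<^bsub>C\<^esub> on_arr (P u) (lam v t X))"
  using fun_cong[OF law_mult_P, of u v t X] assms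
  by (simp add: vcomp_def whisker_left_def whisker_right_def typing)

lemma law_unit_M_component:
  "u \<in> carrier U \<Longrightarrow> X \<in> Obj C
    \<Longrightarrow> lam u \<one>\<^bsub>T\<^esub> X \<cdot>\<^bsub>C\<^esub> on_arr (P u) (\<eta>M X) = \<eta>M (on_obj (P u) X)"
  using fun_cong[OF law_unit_M, of u X]
  by (simp add: vcomp_def whisker_left_def whisker_right_def)

lemma law_unit_P_component:
  "t \<in> carrier T \<Longrightarrow> X \<in> Obj C
    \<Longrightarrow> lam \<one>\<^bsub>U\<^esub> t X \<cdot>\<^bsub>C\<^esub> \<eta>P (on_obj (M t) X) = on_arr (M t) (\<eta>P X)"
  using fun_cong[OF law_unit_P, of t X]
  by (simp add: vcomp_def whisker_left_def whisker_right_def)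

section \<open>The induced multiplication and unit: components, naturality, graded monad
  laws\<close>

abbreviation "cmult \<equiv> composite_mult U C M \<mu>M P \<mu>P lam"
abbreviation "cunit \<equiv> composite_unit U C P \<eta>M \<eta>P"

text \<open>The chosen form of the horizontal composite applies \<open>\<mu>P\<close> under both
  functors first, so \<open>\<mu>M\<close> stands outermost and all the rest lies under
  \<open>M s\<close>.\<close>

lemma cmult_component:
  assumes "s \<in> carrier T" "t \<in> carrier T" "u \<in> carrier U" "v \<in> carrier U" "X \<in> Obj C"
  shows "cmult (s, u) (t, v) X = \<mu>M s t (on_obj (P (u \<otimes>\<^bsub>U\<^esub> v)) X) \<cdot>\<^bsub>C\<^esub>
    (on_arr (M s) (on_arr (M t) (\<mu>P u v X)) \<cdot>\<^bsub>C\<^esub> on_arr (M s) (lam u t (on_obj (P v) X)))"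
  using assms
  by (simp add: composite_mult_def hcomp_def vcomp_def whisker_left_def whisker_right_def typing)

lemma cunit_component:
  "X \<in> Obj C \<Longrightarrow> cunit X = \<eta>M (on_obj (P \<one>\<^bsub>U\<^esub>) X) \<cdot>\<^bsub>C\<^esub> \<eta>P X"
  by (simp add: composite_unit_def hcomp_def vcomp_def whisker_left_def whisker_right_def)

lemma natural_cmult:
  assumes "s \<in> carrier T" "t \<in> carrier T" "u \<in> carrier U" "v \<in> carrier U"
  shows "natural_transformation C ((M s \<circ>F P u) \<circ>F (M t \<circ>F P v))
    (M (s \<otimes>\<^bsub>T\<^esub> t) \<circ>F P (u \<otimes>\<^bsub>U\<^esub> v)) (cmult (s, u) (t, v))"
proof -
  \<comment> \<open>Source and target are bracketed around the law so that the whiskering rules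
    apply; strict associativity of functor composition restores the required bracketing at the
    end.\<close>
  have "natural_transformation C (M s \<circ>F ((P u \<circ>F M t) \<circ>F P v)) (M s \<circ>F ((M t \<circ>F P u) \<circ>F P v))
      (M s \<rhd>\<^bsub>C\<^esub> (lam u t \<lhd>R\<^bsub>C\<^esub> P v))"
    using assms
    by (intro natural_transformation_whisker_left natural_transformation_whisker_right
        natural_law M.functor_M P.functor_M)
  moreover have "natural_transformation C ((M s \<circ>F M t) \<circ>F (P u \<circ>F P v))
      (M (s \<otimes>\<^bsub>T\<^esub> t) \<circ>F P (u \<otimes>\<^bsub>U\<^esub> v))
      (hcomp C (M s \<circ>F M t) (P (u \<otimes>\<^bsub>U\<^esub> v)) (\<mu>M s t) (\<mu>P u v))"
    using assms by (intro natural_transformation_hcomp M.natural_mult P.natural_mult)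
  ultimately show ?thesis
    using natural_transformation_vcomp
    by (simp add: composite_mult_def comp_functor_assoc)
qed

lemma natural_cunit: "natural_transformation C id_functor (M \<one>\<^bsub>T\<^esub> \<circ>F P \<one>\<^bsub>U\<^esub>) cunit"
  using natural_transformation_hcomp[OF M.natural_unit P.natural_unit]
  by (simp add: composite_unit_def comp_id_functor)

lemma cmult_assoc_component:
  assumes T: "r \<in> carrier T" "s \<in> carrier T" "t \<in> carrier T"
    and U: "u \<in> carrier U" "v \<in> carrier U" "w \<in> carrier U" and X: "X \<in> Obj C"
  shows "cmult (r, u) (s \<otimes>\<^bsub>T\<^esub> t, v \<otimes>\<^bsub>U\<^esub> w) X
      \<cdot>\<^bsub>C\<^esub> on_arr (M r) (on_arr (P u) (cmult (s, v) (t, w) X))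
    = cmult (r \<otimes>\<^bsub>T\<^esub> s, u \<otimes>\<^bsub>U\<^esub> v) (t, w) X
      \<cdot>\<^bsub>C\<^esub> cmult (r, u) (s, v) (on_obj (M t) (on_obj (P w) X))"
    (is "?lhs = ?rhs")
proof -
  note [simp] = typing T U X M.m_assoc P.m_assoc
  define PX where "PX = on_obj (P w) X"
  define Y where "Y = on_obj (P (u \<otimes>\<^bsub>U\<^esub> (v \<otimes>\<^bsub>U\<^esub> w))) X"
  have [simp]: "PX \<in> Obj C" "Y \<in> Obj C" by (simp_all add: PX_def Y_def)
  \<comment> \<open>The pieces of the common form: \<pi> multiplies the three \<open>P\<close>
    functors, \<theta> carries \<open>M t\<close> out past \<open>P v\<close> and then
    \<open>P u\<close>, and \<kappa> exchanges \<open>P u\<close> with \<open>M s\<close> under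
    \<open>M r\<close>.\<close>
  define \<pi> where "\<pi> = \<mu>P u (v \<otimes>\<^bsub>U\<^esub> w) X \<cdot>\<^bsub>C\<^esub> on_arr (P u) (\<mu>P v w X)"
  define \<theta> where "\<theta> = lam u t (on_obj (P v) PX) \<cdot>\<^bsub>C\<^esub> on_arr (P u) (lam v t PX)"
  define \<kappa> where "\<kappa> = on_arr (M r) (lam u s (on_obj (P v) (on_obj (M t) PX)))"
  have \<pi> [simp]: "\<pi> \<in> Arr C" "Dom C \<pi> = on_obj (P u) (on_obj (P v) PX)" "Cod C \<pi> = Y"
    by (simp_all add: \<pi>_def PX_def Y_def)
  have \<theta> [simp]: "\<theta> \<in> Arr C" "Dom C \<theta> = on_obj (P u) (on_obj (P v) (on_obj (M t) PX))"
    "Cod C \<theta> = on_obj (M t) (on_obj (P u) (on_obj (P v) PX))"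
    by (simp_all add: \<theta>_def)
  have \<kappa> [simp]: "\<kappa> \<in> Arr C" "Dom C \<kappa> = on_obj (M r) (on_obj (P u) (on_obj (M s) (on_obj (P v) (on_obj (M t) PX))))"
    "Cod C \<kappa> = on_obj (M r) (on_obj (M s) (on_obj (P u) (on_obj (P v) (on_obj (M t) PX))))"
    by (simp_all add: \<kappa>_def)
  let ?normal = "\<mu>M (r \<otimes>\<^bsub>T\<^esub> s) t Y \<cdot>\<^bsub>C\<^esub> (\<mu>M r s (on_obj (M t) Y) \<cdot>\<^bsub>C\<^esub>
    (on_arr (M r) (on_arr (M s) (on_arr (M t) \<pi> \<cdot>\<^bsub>C\<^esub> \<theta>)) \<cdot>\<^bsub>C\<^esub> \<kappa>))"
  have "?rhs = ?normal"
  proof -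
    \<comment> \<open>\<open>?g\<close> is everything in the outer multiplication that lies under
      \<open>M (r \<otimes> s)\<close>.\<close>
    let ?g = "on_arr (M t) (\<mu>P (u \<otimes>\<^bsub>U\<^esub> v) w X) \<cdot>\<^bsub>C\<^esub> lam (u \<otimes>\<^bsub>U\<^esub> v) t PX"
    have g: "?g \<in> Arr C" "Cod C ?g = on_obj (M t) Y"
      "Dom C ?g = on_obj (P (u \<otimes>\<^bsub>U\<^esub> v)) (on_obj (M t) PX)"
      by (simp_all add: Y_def PX_def)
    have "?rhs = \<mu>M (r \<otimes>\<^bsub>T\<^esub> s) t Y \<cdot>\<^bsub>C\<^esub> ((on_arr (M (r \<otimes>\<^bsub>T\<^esub> s)) ?g
        \<cdot>\<^bsub>C\<^esub> \<mu>M r s (on_obj (P (u \<otimes>\<^bsub>U\<^esub> v)) (on_obj (M t) PX)))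
        \<cdot>\<^bsub>C\<^esub> (on_arr (M r) (on_arr (M s) (\<mu>P u v (on_obj (M t) PX))) \<cdot>\<^bsub>C\<^esub> \<kappa>))"
      by (simp add: cmult_component PX_def Y_def \<kappa>_def)
    \<comment> \<open>Naturality of \<open>\<mu>M r s\<close> at \<open>?g\<close> brings it to the
      front; \<open>simp only\<close> keeps \<open>?g\<close> from being split by
      functoriality.\<close>
    also have "on_arr (M (r \<otimes>\<^bsub>T\<^esub> s)) ?g \<cdot>\<^bsub>C\<^esub> \<mu>M r s (on_obj (P (u \<otimes>\<^bsub>U\<^esub> v)) (on_obj (M t) PX))
        = \<mu>M r s (on_obj (M t) Y) \<cdot>\<^bsub>C\<^esub> on_arr (M r) (on_arr (M s) ?g)"
      using M.mult_natural[of r s ?g] g by (simp only: T)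
    also have "\<mu>M (r \<otimes>\<^bsub>T\<^esub> s) t Y \<cdot>\<^bsub>C\<^esub> (\<dots>
        \<cdot>\<^bsub>C\<^esub> (on_arr (M r) (on_arr (M s) (\<mu>P u v (on_obj (M t) PX))) \<cdot>\<^bsub>C\<^esub> \<kappa>))
      = \<mu>M (r \<otimes>\<^bsub>T\<^esub> s) t Y \<cdot>\<^bsub>C\<^esub> (\<mu>M r s (on_obj (M t) Y)
        \<cdot>\<^bsub>C\<^esub> (on_arr (M r) (on_arr (M s) (?g \<cdot>\<^bsub>C\<^esub> \<mu>P u v (on_obj (M t) PX))) \<cdot>\<^bsub>C\<^esub> \<kappa>))"
      by (simp add: PX_def Y_def)
    \<comment> \<open>The law's compatibility with \<open>\<mu>P\<close> splits the exchange past
      the product \<open>u \<otimes> v\<close> into \<theta>; associativity of \<open>P\<close>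
      turns the remaining multiplications into \<pi>.\<close>
    also have "?g \<cdot>\<^bsub>C\<^esub> \<mu>P u v (on_obj (M t) PX) = on_arr (M t) \<pi> \<cdot>\<^bsub>C\<^esub> \<theta>"
    proof -
      have "?g \<cdot>\<^bsub>C\<^esub> \<mu>P u v (on_obj (M t) PX) = on_arr (M t) (\<mu>P (u \<otimes>\<^bsub>U\<^esub> v) w X)
          \<cdot>\<^bsub>C\<^esub> (lam (u \<otimes>\<^bsub>U\<^esub> v) t PX \<cdot>\<^bsub>C\<^esub> \<mu>P u v (on_obj (M t) PX))"
        by (simp add: PX_def)
      also have "\<dots> = on_arr (M t) (\<mu>P (u \<otimes>\<^bsub>U\<^esub> v) w X \<cdot>\<^bsub>C\<^esub> \<mu>P u v PX) \<cdot>\<^bsub>C\<^esub> \<theta>"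
        unfolding \<theta>_def by (subst law_mult_P_component) (simp_all add: PX_def)
      finally show ?thesis
        by (simp only: \<pi>_def PX_def P.mult_assoc_component[OF U X])
    qed
    finally show ?thesis .
  qed
  moreover have "?lhs = ?normal"
  proof -
    let ?Z = "on_obj (P (v \<otimes>\<^bsub>U\<^esub> w)) X"
    \<comment> \<open>\<open>?f\<close> is the part of the inner multiplication under
      \<open>M s\<close>, and \<open>?h\<close> below is the outer multiplication of
      \<open>P\<close>.\<close>
    let ?f = "on_arr (M t) (\<mu>P v w X) \<cdot>\<^bsub>C\<^esub> lam v t PX"
    have f: "?f \<in> Arr C" "Cod C ?f = on_obj (M t) ?Z"
      "Dom C ?f = on_obj (P v) (on_obj (M t) PX)"
      by (simp_all add: PX_def)
    let ?h = "\<mu>P u (v \<otimes>\<^bsub>U\<^esub> w) X"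
    \<comment> \<open>Naturality of the law at \<open>\<mu>P v w\<close> moves this multiplication
      past the exchange, where it joins \<open>?h\<close> to form \<pi>; the two exchanges left over
      form \<theta>.\<close>
    have inner: "on_arr (M t) ?h \<cdot>\<^bsub>C\<^esub> (lam u t ?Z \<cdot>\<^bsub>C\<^esub> on_arr (P u) ?f) = on_arr (M t) \<pi> \<cdot>\<^bsub>C\<^esub> \<theta>"
    proof -
      have "lam u t ?Z \<cdot>\<^bsub>C\<^esub> on_arr (P u) ?f
          = (lam u t ?Z \<cdot>\<^bsub>C\<^esub> on_arr (P u) (on_arr (M t) (\<mu>P v w X))) \<cdot>\<^bsub>C\<^esub> on_arr (P u) (lam v t PX)"
        by (simp add: PX_def)
      also have "lam u t ?Z \<cdot>\<^bsub>C\<^esub> on_arr (P u) (on_arr (M t) (\<mu>P v w X))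
          = on_arr (M t) (on_arr (P u) (\<mu>P v w X)) \<cdot>\<^bsub>C\<^esub> lam u t (on_obj (P v) PX)"
        using law_natural[of u t "\<mu>P v w X"] by (simp add: PX_def)
      finally show ?thesis by (simp add: \<pi>_def \<theta>_def PX_def)
    qed
    \<comment> \<open>The bracketing isolates the exchange with \<open>M (s \<otimes> t)\<close>
      after \<open>\<mu>M s t\<close>, to which the compatibility with \<open>\<mu>M\<close>
      applies.\<close>
    have "?lhs = \<mu>M r (s \<otimes>\<^bsub>T\<^esub> t) Y \<cdot>\<^bsub>C\<^esub> on_arr (M r) (on_arr (M (s \<otimes>\<^bsub>T\<^esub> t)) ?h
        \<cdot>\<^bsub>C\<^esub> ((lam u (s \<otimes>\<^bsub>T\<^esub> t) ?Z \<cdot>\<^bsub>C\<^esub> on_arr (P u) (\<mu>M s t ?Z))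
        \<cdot>\<^bsub>C\<^esub> on_arr (P u) (on_arr (M s) ?f)))"
      by (simp add: cmult_component PX_def Y_def)
    also have "lam u (s \<otimes>\<^bsub>T\<^esub> t) ?Z \<cdot>\<^bsub>C\<^esub> on_arr (P u) (\<mu>M s t ?Z)
        = \<mu>M s t (on_obj (P u) ?Z) \<cdot>\<^bsub>C\<^esub> (on_arr (M s) (lam u t ?Z) \<cdot>\<^bsub>C\<^esub> lam u s (on_obj (M t) ?Z))"
      by (rule law_mult_M_component) simp_all
    also have "on_arr (M (s \<otimes>\<^bsub>T\<^esub> t)) ?h \<cdot>\<^bsub>C\<^esub> (\<dots> \<cdot>\<^bsub>C\<^esub> on_arr (P u) (on_arr (M s) ?f))
        = (on_arr (M (s \<otimes>\<^bsub>T\<^esub> t)) ?h \<cdot>\<^bsub>C\<^esub> \<mu>M s t (on_obj (P u) ?Z))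
          \<cdot>\<^bsub>C\<^esub> (on_arr (M s) (lam u t ?Z)
          \<cdot>\<^bsub>C\<^esub> (lam u s (on_obj (M t) ?Z) \<cdot>\<^bsub>C\<^esub> on_arr (P u) (on_arr (M s) ?f)))"
      by (simp add: PX_def)
    also have "on_arr (M (s \<otimes>\<^bsub>T\<^esub> t)) ?h \<cdot>\<^bsub>C\<^esub> \<mu>M s t (on_obj (P u) ?Z)
        = \<mu>M s t Y \<cdot>\<^bsub>C\<^esub> on_arr (M s) (on_arr (M t) ?h)"
      using M.mult_natural[of s t ?h] by (simp add: Y_def)
    \<comment> \<open>Naturality at \<open>?f\<close> leaves the exchange of \<open>P u\<close> with
      \<open>M s\<close> innermost; under \<open>M r\<close> it becomes \<kappa>.\<close>
    also have "lam u s (on_obj (M t) ?Z) \<cdot>\<^bsub>C\<^esub> on_arr (P u) (on_arr (M s) ?f)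
        = on_arr (M s) (on_arr (P u) ?f) \<cdot>\<^bsub>C\<^esub> lam u s (on_obj (P v) (on_obj (M t) PX))"
      using law_natural[of u s ?f] f by (simp only: T U)
    also have "(\<mu>M s t Y \<cdot>\<^bsub>C\<^esub> on_arr (M s) (on_arr (M t) ?h)) \<cdot>\<^bsub>C\<^esub> (on_arr (M s) (lam u t ?Z) \<cdot>\<^bsub>C\<^esub> \<dots>)
        = \<mu>M s t Y \<cdot>\<^bsub>C\<^esub> (on_arr (M s) (on_arr (M t) ?h \<cdot>\<^bsub>C\<^esub> (lam u t ?Z \<cdot>\<^bsub>C\<^esub> on_arr (P u) ?f))
          \<cdot>\<^bsub>C\<^esub> lam u s (on_obj (P v) (on_obj (M t) PX)))"
      by (simp add: PX_def Y_def)
    also note inner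
    also have "\<mu>M r (s \<otimes>\<^bsub>T\<^esub> t) Y \<cdot>\<^bsub>C\<^esub> on_arr (M r) (\<mu>M s t Y
        \<cdot>\<^bsub>C\<^esub> (on_arr (M s) (on_arr (M t) \<pi> \<cdot>\<^bsub>C\<^esub> \<theta>) \<cdot>\<^bsub>C\<^esub> lam u s (on_obj (P v) (on_obj (M t) PX))))
      = (\<mu>M r (s \<otimes>\<^bsub>T\<^esub> t) Y \<cdot>\<^bsub>C\<^esub> on_arr (M r) (\<mu>M s t Y))
        \<cdot>\<^bsub>C\<^esub> (on_arr (M r) (on_arr (M s) (on_arr (M t) \<pi> \<cdot>\<^bsub>C\<^esub> \<theta>)) \<cdot>\<^bsub>C\<^esub> \<kappa>)"
      by (simp add: \<kappa>_def)
    \<comment> \<open>Only the order of the two multiplications of \<open>M\<close> still differs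
      from the common form.\<close>
    also have "\<mu>M r (s \<otimes>\<^bsub>T\<^esub> t) Y \<cdot>\<^bsub>C\<^esub> on_arr (M r) (\<mu>M s t Y)
        = \<mu>M (r \<otimes>\<^bsub>T\<^esub> s) t Y \<cdot>\<^bsub>C\<^esub> \<mu>M r s (on_obj (M t) Y)"
      by (rule M.mult_assoc_component) simp_all
    finally show ?thesis by simp
  qed
  ultimately show ?thesis by simp
qed

text \<open>The unit law for \<open>\<eta>M\<close> absorbs the exchange, and naturality moves
  \<open>\<eta>M\<close> in front of \<open>\<mu>P\<close>. Then the right unit laws of
  \<open>P\<close> and of \<open>M\<close> cancel the units in turn.\<close>

lemma cmult_unit_right_component:
  assumes t: "t \<in> carrier T" and u: "u \<in> carrier U" and X: "X \<in> Obj C"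
  shows "cmult (t, u) (\<one>\<^bsub>T\<^esub>, \<one>\<^bsub>U\<^esub>) X \<cdot>\<^bsub>C\<^esub> on_arr (M t) (on_arr (P u) (cunit X))
    = Ident C (on_obj (M t) (on_obj (P u) X))"
proof -
  note [simp] = typing t u X
  let ?Z = "on_obj (P \<one>\<^bsub>U\<^esub>) X" and ?Y = "on_obj (P u) X"
  have "cmult (t, u) (\<one>\<^bsub>T\<^esub>, \<one>\<^bsub>U\<^esub>) X \<cdot>\<^bsub>C\<^esub> on_arr (M t) (on_arr (P u) (cunit X))
      = \<mu>M t \<one>\<^bsub>T\<^esub> ?Y \<cdot>\<^bsub>C\<^esub> on_arr (M t) (on_arr (M \<one>\<^bsub>T\<^esub>) (\<mu>P u \<one>\<^bsub>U\<^esub> X)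
        \<cdot>\<^bsub>C\<^esub> ((lam u \<one>\<^bsub>T\<^esub> ?Z \<cdot>\<^bsub>C\<^esub> on_arr (P u) (\<eta>M ?Z)) \<cdot>\<^bsub>C\<^esub> on_arr (P u) (\<eta>P X)))"
    by (simp add: cmult_component cunit_component)
  also have "lam u \<one>\<^bsub>T\<^esub> ?Z \<cdot>\<^bsub>C\<^esub> on_arr (P u) (\<eta>M ?Z) = \<eta>M (on_obj (P u) ?Z)"
    by (rule law_unit_M_component) simp_all
  also have "on_arr (M \<one>\<^bsub>T\<^esub>) (\<mu>P u \<one>\<^bsub>U\<^esub> X) \<cdot>\<^bsub>C\<^esub> (\<dots> \<cdot>\<^bsub>C\<^esub> on_arr (P u) (\<eta>P X))
      = (on_arr (M \<one>\<^bsub>T\<^esub>) (\<mu>P u \<one>\<^bsub>U\<^esub> X) \<cdot>\<^bsub>C\<^esub> \<eta>M (on_obj (P u) ?Z)) \<cdot>\<^bsub>C\<^esub> on_arr (P u) (\<eta>P X)"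
    by simp
  also have "on_arr (M \<one>\<^bsub>T\<^esub>) (\<mu>P u \<one>\<^bsub>U\<^esub> X) \<cdot>\<^bsub>C\<^esub> \<eta>M (on_obj (P u) ?Z) = \<eta>M ?Y \<cdot>\<^bsub>C\<^esub> \<mu>P u \<one>\<^bsub>U\<^esub> X"
    using M.unit_natural[of "\<mu>P u \<one>\<^bsub>U\<^esub> X"] by simp
  also have "\<dots> \<cdot>\<^bsub>C\<^esub> on_arr (P u) (\<eta>P X) = \<eta>M ?Y"
    using P.mult_unit_right_component[of u X] by simp
  also have "\<mu>M t \<one>\<^bsub>T\<^esub> ?Y \<cdot>\<^bsub>C\<^esub> on_arr (M t) (\<eta>M ?Y) = Ident C (on_obj (M t) ?Y)"
    by (rule M.mult_unit_right_component) simp_all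
  finally show ?thesis .
qed

text \<open>Here \<open>\<eta>M\<close> is first moved past the exchange and \<open>\<mu>P\<close>
  together, which brings the exchange next to \<open>\<eta>P\<close>. The unit law for
  \<open>\<eta>P\<close> absorbs it, and the left unit laws of \<open>P\<close> and of
  \<open>M\<close> finish.\<close>

lemma cmult_unit_left_component:
  assumes t: "t \<in> carrier T" and u: "u \<in> carrier U" and X: "X \<in> Obj C"
  shows "cmult (\<one>\<^bsub>T\<^esub>, \<one>\<^bsub>U\<^esub>) (t, u) X \<cdot>\<^bsub>C\<^esub> cunit (on_obj (M t) (on_obj (P u) X))
    = Ident C (on_obj (M t) (on_obj (P u) X))"
proof -
  note [simp] = typing t u X
  let ?Y = "on_obj (P u) X"
  let ?f = "on_arr (M t) (\<mu>P \<one>\<^bsub>U\<^esub> u X) \<cdot>\<^bsub>C\<^esub> lam \<one>\<^bsub>U\<^esub> t ?Y"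
  have "cmult (\<one>\<^bsub>T\<^esub>, \<one>\<^bsub>U\<^esub>) (t, u) X \<cdot>\<^bsub>C\<^esub> cunit (on_obj (M t) ?Y)
      = \<mu>M \<one>\<^bsub>T\<^esub> t ?Y \<cdot>\<^bsub>C\<^esub> ((on_arr (M \<one>\<^bsub>T\<^esub>) ?f \<cdot>\<^bsub>C\<^esub> \<eta>M (on_obj (P \<one>\<^bsub>U\<^esub>) (on_obj (M t) ?Y)))
        \<cdot>\<^bsub>C\<^esub> \<eta>P (on_obj (M t) ?Y))"
    by (simp add: cmult_component cunit_component)
  also have "on_arr (M \<one>\<^bsub>T\<^esub>) ?f \<cdot>\<^bsub>C\<^esub> \<eta>M (on_obj (P \<one>\<^bsub>U\<^esub>) (on_obj (M t) ?Y)) = \<eta>M (on_obj (M t) ?Y) \<cdot>\<^bsub>C\<^esub> ?f"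
    using M.unit_natural[of ?f] by simp
  also have "\<dots> \<cdot>\<^bsub>C\<^esub> \<eta>P (on_obj (M t) ?Y)
      = \<eta>M (on_obj (M t) ?Y) \<cdot>\<^bsub>C\<^esub> (on_arr (M t) (\<mu>P \<one>\<^bsub>U\<^esub> u X)
        \<cdot>\<^bsub>C\<^esub> (lam \<one>\<^bsub>U\<^esub> t ?Y \<cdot>\<^bsub>C\<^esub> \<eta>P (on_obj (M t) ?Y)))"
    by simp
  also have "lam \<one>\<^bsub>U\<^esub> t ?Y \<cdot>\<^bsub>C\<^esub> \<eta>P (on_obj (M t) ?Y) = on_arr (M t) (\<eta>P ?Y)"
    by (rule law_unit_P_component) simp_all
  also have "on_arr (M t) (\<mu>P \<one>\<^bsub>U\<^esub> u X) \<cdot>\<^bsub>C\<^esub> \<dots> = on_arr (M t) (\<mu>P \<one>\<^bsub>U\<^esub> u X \<cdot>\<^bsub>C\<^esub> \<eta>P ?Y)"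
    by simp
  also have "\<mu>P \<one>\<^bsub>U\<^esub> u X \<cdot>\<^bsub>C\<^esub> \<eta>P ?Y = Ident C ?Y"
    by (rule P.mult_unit_left_component) simp_all
  also have "\<eta>M (on_obj (M t) ?Y) \<cdot>\<^bsub>C\<^esub> on_arr (M t) \<dots> = \<eta>M (on_obj (M t) ?Y)"
    by simp
  also have "\<mu>M \<one>\<^bsub>T\<^esub> t ?Y \<cdot>\<^bsub>C\<^esub> \<dots> = Ident C (on_obj (M t) ?Y)"
    by (rule M.mult_unit_left_component) simp_all
  finally show ?thesis .
qed

text \<open>Splitting the grades into pairs and comparing the restricted families object by object
  reduces each monad law to its component form above.\<close>

lemma composite_graded_monad: "graded_monad (T \<times>\<times> U) C (composite_functor M P) cmult cunit"
proof (intro graded_monad.intro graded_monad_axioms.intro)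
  show "monoid (T \<times>\<times> U)"
    by (rule DirProd_monoid) (rule M.monoid_axioms P.monoid_axioms)+
  show "category C" by (rule M.category_axioms)
qed (auto simp: composite_functor_def natural_cmult natural_cunit endofunctor_comp
    M.functor_M P.functor_M vcomp_def whisker_left_def whisker_right_def id_nt_def
    M.M_simps P.M_simps cmult_assoc_component cmult_unit_right_component
    cmult_unit_left_component intro!: restrict_ext)

end

theorem theorem3p5:
  fixes T :: "('t, 'a) monoid_scheme" and U :: "('u, 'b) monoid_scheme"
    and C :: "('o, 'm, 'c) category_scheme"
    and M :: "'t \<Rightarrow> ('o, 'm) endofunctor"
    and \<mu>M :: "'t \<Rightarrow> 't \<Rightarrow> 'o \<Rightarrow> 'm" and \<eta>M :: "'o \<Rightarrow> 'm"
    and P :: "'u \<Rightarrow> ('o, 'm) endofunctor"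
    and \<mu>P :: "'u \<Rightarrow> 'u \<Rightarrow> 'o \<Rightarrow> 'm" and \<eta>P :: "'o \<Rightarrow> 'm"
    and lam :: "'u \<Rightarrow> 't \<Rightarrow> 'o \<Rightarrow> 'm"
  assumes "monoid T" and "monoid U" and "category C"
    and "graded_monad T C M \<mu>M \<eta>M"
    and "graded_monad U C P \<mu>P \<eta>P"
    and "graded_distributive_law T U C M \<mu>M \<eta>M P \<mu>P \<eta>P lam"
  shows "graded_monad (T \<times>\<times> U) C (composite_functor M P)
    (composite_mult U C M \<mu>M P \<mu>P lam)
    (composite_unit U C P \<eta>M \<eta>P)"
  using assms(6) by (rule graded_distributive_law.composite_graded_monad)

end
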